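(* Let $n\ge 5$ be an odd integer, $\ell\ge0$ an integer, and let $\mathfrak g$ be of type $D_n^{(1)}$. Let $$\upsilon=(0,n,1,n-1)(2,3)(4,5)\cdots(n-3,n-2)\in\mathfrak S_{\{0,\dots,n\}},$$ a permutation of order $4$, and let the cyclic group $C_4=\langle\sigma_4\rangle$ of order $4$ act on the set $P^+_{\mathrm{cl},\ell}$ of classical dominant integral weights of level $\ell$ by $$\sigma_4\cdot\sum_{i=0}^n m_i\Lambda_i=\sum_{i=0}^n m_{\upsilon(i)}\Lambda_i .$$ Let $(s_0,s_1,\dots,s_n)=(0,2,0,2,0,\dots,0,2,1,3)$, i.e. $s_i=0$ for even $i\le n-3$, $s_i=2$ for odd $i\le n-2$, $s_{n-1}=1$, $s_n=3$, and let $$P^+_{\mathrm{cl},\ell}(q)=\sum_{\sum_i m_i\Lambda_i\in P^+_{\mathrm{cl},\ell}} q^{\,\sum_{i=0}^n s_i m_i}.$$ Then the triple $\bigl(P^+_{\mathrm{cl},\ell},\,C_4,\,P^+_{\mathrm{cl},\ell}(q)\bigr)$ exhibits the cyclic sieving phenomenon.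
   Context: For type $D_n^{(1)}$ the canonical central element is $c=\sum_{i=0}^n a_i^\vee h_i$ with $(a_0^\vee,\dots,a_n^\vee)=(1,1,2,2,\dots,2,1,1)$ (with $n-3$ twos, in positions $2,\dots,n-2$). Classical dominant integral weights of level $\ell$ (dominant integral weights of level $\ell$ modulo $\mathbb Z\delta$) are identified with $P^+_{\mathrm{cl},\ell}=\{\sum_{i=0}^n m_i\Lambda_i: m_i\in\mathbb Z_{\ge0},\ \sum_{i=0}^n a_i^\vee m_i=\ell\}$. Cyclic sieving phenomenon: for a finite set $X$ with an action of a finite cyclic group $C$, and a polynomial $X(q)$ with nonnegative integer coefficients, the triple $(X,C,X(q))$ exhibits the cyclic sieving phenomenon if for every $g\in C$ one has $|X^g|=X(\omega_{o(g)})$, where $o(g)$ is the order of $g$, $\omega_d$ is a primitive $d$-th root of unity, and $X^g$ is the set of points fixed by $g$. *)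

theory Defs
  imports
    "HOL-Algebra.Group_Action"
    "HOL-Algebra.Elementary_Groups"
    "HOL-Algebra.Multiplicative_Group"
    "HOL-Combinatorics.Permutations"
    "HOL-Computational_Algebra.Polynomial"
    Complex_Main
begin

definition primitive_root_of_unity :: "nat \<Rightarrow> complex \<Rightarrow> bool" where
  "primitive_root_of_unity d \<omega> \<longleftrightarrow> d > 0 \<and> \<omega> ^ d = 1 \<and> (\<forall>k. 0 < k \<and> k < d \<longrightarrow> \<omega> ^ k \<noteq> 1)"

text \<open>
  The polynomial has type \<open>nat poly\<close>, so its coefficients are nonnegative integers.
  The evaluation identity is required for every choice of primitive root of unity.
\<close>

definition cyclic_sieving ::
  "('g, 'r) monoid_scheme \<Rightarrow> 'x set \<Rightarrow> ('g \<Rightarrow> 'x \<Rightarrow> 'x) \<Rightarrow> nat poly \<Rightarrow> bool" where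
  "cyclic_sieving C X \<phi> P \<longleftrightarrow>
     finite X \<and> group C \<and> cyclic_group C \<and> finite (carrier C) \<and> group_action C X \<phi> \<and>
     (\<forall>g \<in> carrier C. \<forall>\<omega>. primitive_root_of_unity (group.ord C g) \<omega> \<longrightarrow>
        of_nat (card {x \<in> X. \<phi> g x = x}) = poly (map_poly of_nat P) \<omega>)"

text \<open>The coefficients \<open>a\<^sub>i\<^sup>\<or>\<close> (for \<open>i \<le> n\<close>) of the canonical central element in type \<open>D\<^sub>n\<^sup>(\<^sup>1\<^sup>)\<close>.\<close>

definition comark_D :: "nat \<Rightarrow> nat \<Rightarrow> nat" where
  "comark_D n i = (if i \<in> {0, 1, n - 1, n} then 1 else 2)"

text \<open>
  The weight \<open>\<Sum>i\<le>n. m\<^sub>i \<Lambda>\<^sub>i\<close> is encoded by its coefficient function \<open>m\<close>, extended by \<open>0\<close>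
  beyond \<open>n\<close>.
\<close>

definition dom_weights_D :: "nat \<Rightarrow> nat \<Rightarrow> (nat \<Rightarrow> nat) set" where
  "dom_weights_D n l = {m. (\<forall>i>n. m i = 0) \<and> (\<Sum>i\<le>n. comark_D n i * m i) = l}"

text \<open>
  For odd \<open>n \<ge> 5\<close>, the permutation \<open>(0, n, 1, n-1) (2, 3) (4, 5) \<dots> (n-3, n-2)\<close>, extended by the
  identity beyond \<open>n\<close>.
\<close>

definition upsilon :: "nat \<Rightarrow> nat \<Rightarrow> nat" where
  "upsilon n i =
     (if i = 0 then n
      else if i = n then 1
      else if i = 1 then n - 1
      else if i = n - 1 then 0
      else if i > n then i
      else if even i then i + 1
      else i - 1)"

lemma upsilon_le: "odd n \<Longrightarrow> n \<ge> 5 \<Longrightarrow> i \<le> n \<Longrightarrow> upsilon n i \<le> n"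
  unfolding upsilon_def by auto

lemma upsilon_pow4:
  assumes "odd n" "n \<ge> 5"
  shows "(upsilon n ^^ 4) i = i"
proof -
  let ?u = "upsilon n"
  have ne: "n \<noteq> 0" "n \<noteq> 1" "n - 1 \<noteq> 0" "n - 1 \<noteq> 1" "n - 1 \<noteq> n"
    using assms by linarith+
  have cyc: "?u 0 = n" "?u n = 1" "?u 1 = n - 1" "?u (n - 1) = 0"
    unfolding upsilon_def using ne by presburger+
  have swap: "?u (?u i) = i" if "i \<notin> {0, 1, n - 1, n}"
  proof (cases "i > n")
    case True
    then show ?thesis using that by (simp add: upsilon_def)
  next
    case False
    with that assms have i: "2 \<le> i" "i < n - 1" by auto
    show ?thesis
    proof (cases "even i")
      case True
      with i assms have "i + 1 \<noteq> n - 1" "i + 1 < n"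
        by presburger+
      with True i have "?u i = i + 1" "?u (i + 1) = i"
        unfolding upsilon_def by presburger+
      then show ?thesis by simp
    next
      case odd: False
      with i have "i - 1 \<noteq> 0" "i - 1 \<noteq> 1" "even (i - 1)"
        by presburger+
      with odd i have "?u i = i - 1" "?u (i - 1) = i"
        unfolding upsilon_def by presburger+
      then show ?thesis by simp
    qed
  qed
  have "?u (?u (?u (?u i))) = i"
  proof (cases "i \<in> {0, 1, n - 1, n}")
    case True
    then show ?thesis using cyc by auto
  next
    case False
    then show ?thesis using swap by simp
  qed
  then show ?thesis by (simp add: numeral_eq_Suc)
qed

lemma upsilon_permutes:
  assumes "odd n" "n \<ge> 5"
  shows "upsilon n permutes {..n}"
proof (rule bij_imp_permutes)
  have inj: "inj (upsilon n)"
    by (rule inj_on_inverseI[where g = "upsilon n ^^ 3"])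
       (use upsilon_pow4[OF assms] in \<open>simp add: numeral_eq_Suc\<close>)
  have "upsilon n ` {..n} = {..n}"
    by (rule endo_inj_surj) (use upsilon_le[OF assms] inj_on_subset[OF inj] in auto)
  then show "bij_betw (upsilon n) {..n} {..n}"
    using inj_on_subset[OF inj] by (auto simp: bij_betw_def)
  show "upsilon n i = i" if "i \<notin> {..n}" for i
    using that assms by (auto simp: upsilon_def)
qed

text \<open>
  The action of the cyclic group \<open>integer_mod_group 4\<close>, whose element \<open>k\<close> stands for \<open>\<sigma>\<^sub>4\<^sup>k\<close>: the
  generator \<open>1\<close> sends \<open>\<Sum>i\<le>n. m\<^sub>i \<Lambda>\<^sub>i\<close> to \<open>\<Sum>i\<le>n. m\<^bsub>upsilon n i\<^esub> \<Lambda>\<^sub>i\<close>.  The restriction is needed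
  because \<open>BijGroup\<close> consists of extensional functions.
\<close>

definition sigma4_action :: "nat \<Rightarrow> nat \<Rightarrow> int \<Rightarrow> (nat \<Rightarrow> nat) \<Rightarrow> (nat \<Rightarrow> nat)" where
  "sigma4_action n l k = (\<lambda>m \<in> dom_weights_D n l. m \<circ> (upsilon n ^^ nat k))"

lemma sigma4_action_generator:
  "m \<in> dom_weights_D n l \<Longrightarrow> sigma4_action n l 1 m = (\<lambda>i. m (upsilon n i))"
  by (simp add: sigma4_action_def comp_def)

text \<open>The tuple \<open>(0, 2, 0, 2, \<dots>, 0, 2, 1, 3)\<close> for odd \<open>n\<close> (relevant for \<open>i \<le> n\<close>).\<close>

definition s_D :: "nat \<Rightarrow> nat \<Rightarrow> nat" where
  "s_D n i = (if i = n then 3 else if i = n - 1 then 1 else if even i then 0 else 2)"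

definition dom_weights_poly :: "nat \<Rightarrow> nat \<Rightarrow> nat poly" where
  "dom_weights_poly n l =
     (\<Sum>m \<in> dom_weights_D n l. Polynomial.monom 1 (\<Sum>i\<le>n. s_D n i * m i))"

end

theory Submission
  imports Defs "HOL-Computational_Algebra.Formal_Power_Series"
begin

text \<open>
  Summed over all levels \<open>l\<close> against \<open>X\<^sup>l\<close>, the values of the polynomial at a root of unity \<open>\<omega>\<close>
  become \<open>\<Prod>i\<le>n. 1 / (1 - \<omega>\<^bsup>s i\<^esup> X\<^bsup>a i\<^esup>)\<close>, where \<open>a\<close> are the comarks.  A weight is fixed by a
  permutation iff it is constant on its cycles, so the numbers of fixed weights have generating
  function \<open>\<Prod>j. 1 / (1 - X\<^bsup>b j\<^esup>)\<close>, where \<open>j\<close> ranges over the cycles and \<open>b j\<close> is the sum of \<open>a\<close>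
  over the cycle \<open>j\<close>.  It remains to compare the denominators.  For \<open>\<omega>\<^sup>2 = -1\<close> this is done cycle
  by cycle, with \<open>(1 - X) (1 + X) (1 - \<omega> X) (1 + \<omega> X) = 1 - X\<^sup>4\<close> and \<open>(1 - X\<^sup>2) (1 + X\<^sup>2) = 1 - X\<^sup>4\<close>.
  For \<open>\<omega> = -1\<close> the factors match only across the cycles \<open>(0, 1)\<close> and \<open>(n-1, n)\<close>:
  \<open>(1 - X)\<^sup>2 (1 + X)\<^sup>2 = (1 - X\<^sup>2)\<^sup>2\<close>.
\<close>

section \<open>Generating functions of weighted solution sets\<close>

definition weighted_sols :: "'a set \<Rightarrow> ('a \<Rightarrow> nat) \<Rightarrow> nat \<Rightarrow> ('a \<Rightarrow> nat) set" where
  "weighted_sols I a l = {m. (\<forall>i. i \<notin> I \<longrightarrow> m i = 0) \<and> (\<Sum>i\<in>I. a i * m i) = l}"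

lemma finite_weighted_sols:
  assumes "finite I" "\<And>i. i \<in> I \<Longrightarrow> a i > 0"
  shows "finite (weighted_sols I a l)"
proof (rule finite_subset)
  show "weighted_sols I a l \<subseteq> {m. \<forall>i. (i \<in> I \<longrightarrow> m i \<in> {..l}) \<and> (i \<notin> I \<longrightarrow> m i = 0)}"
  proof
    fix m assume m: "m \<in> weighted_sols I a l"
    have "m i \<le> l" if "i \<in> I" for i
    proof -
      have "m i \<le> a i * m i" using assms(2)[OF that] by simp
      also have "\<dots> \<le> (\<Sum>i\<in>I. a i * m i)"
        using that assms(1) by (intro member_le_sum) auto
      finally show ?thesis using m by (simp add: weighted_sols_def)
    qed
    with m show "m \<in> {m. \<forall>i. (i \<in> I \<longrightarrow> m i \<in> {..l}) \<and> (i \<notin> I \<longrightarrow> m i = 0)}"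
      by (simp add: weighted_sols_def)
  qed
  show "finite {m. \<forall>i. (i \<in> I \<longrightarrow> m i \<in> {..l}) \<and> (i \<notin> I \<longrightarrow> m i = (0::nat))}"
    using assms(1) by (intro finite_set_of_finite_funs) auto
qed

text \<open>The parameters \<open>c\<close> serve two purposes: \<open>c i = 1\<close> counts
  solutions, while \<open>c i = \<omega> ^ s_D n i\<close> gives the values of the polynomial at
  \<open>\<omega>\<close>.\<close>

definition weighted_gf :: "'a set \<Rightarrow> ('a \<Rightarrow> nat) \<Rightarrow> ('a \<Rightarrow> 'b::idom) \<Rightarrow> 'b fps" where
  "weighted_gf I a c = Abs_fps (\<lambda>l. \<Sum>m\<in>weighted_sols I a l. \<Prod>i\<in>I. c i ^ m i)"

text \<open>Either \<open>m i = 0\<close>, or \<open>m i\<close> can be lowered by one, which leaves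
  a solution over the same index set with total \<open>l - a i\<close>. This recursion replaces a
  sum over all values of \<open>m i\<close>. The test \<open>l < a i\<close> guards against
  truncated subtraction.\<close>

lemma weighted_sols_insert:
  assumes "finite I" "i \<notin> I" "a i > 0"
  shows "weighted_sols (insert i I) a l = weighted_sols I a l \<union>
    (if l < a i then {} else (\<lambda>m. m(i := Suc (m i))) ` weighted_sols (insert i I) a (l - a i))"
    (is "?L = ?R")
proof (intro equalityI subsetI)
  fix m assume m: "m \<in> ?L"
  show "m \<in> ?R"
  proof (cases "m i")
    case 0
    with m have "m j = 0" if "j \<notin> I" for j
      using that by (cases "j = i") (auto simp: weighted_sols_def)
    with m 0 assms have "m \<in> weighted_sols I a l" by (simp add: weighted_sols_def)
    then show ?thesis by simp
  next
    case (Suc k)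
    let ?m = "m(i := k)"
    have s: "(\<Sum>j\<in>I. a j * ?m j) = (\<Sum>j\<in>I. a j * m j)"
      using assms by (intro sum.cong) auto
    have l: "l = a i + (a i * k + (\<Sum>j\<in>I. a j * m j))"
      using m Suc assms by (simp add: weighted_sols_def)
    have "?m \<in> weighted_sols (insert i I) a (l - a i)"
      using m l s assms by (auto simp: weighted_sols_def)
    moreover have "m = ?m(i := Suc (?m i))" using Suc by auto
    ultimately have "m \<in> (\<lambda>m. m(i := Suc (m i))) ` weighted_sols (insert i I) a (l - a i)"
      by - (rule image_eqI[where x = ?m]; assumption)
    then show ?thesis using l by simp
  qed
next
  fix m assume m: "m \<in> ?R"
  then consider "m \<in> weighted_sols I a l"
    | k where "l \<ge> a i" "k \<in> weighted_sols (insert i I) a (l - a i)" "m = k(i := Suc (k i))"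
    by (auto split: if_splits)
  then show "m \<in> ?L"
  proof cases
    case 1
    with assms show ?thesis by (auto simp: weighted_sols_def)
  next
    case 2
    have "(\<Sum>j\<in>I. a j * m j) = (\<Sum>j\<in>I. a j * k j)"
      using assms 2 by (intro sum.cong) auto
    with 2 assms show ?thesis by (auto simp: weighted_sols_def)
  qed
qed

text \<open>Coefficientwise this is the recursion of \<open>weighted_sols_insert\<close>: raising
  \<open>m i\<close> by one multiplies the term by \<open>c i\<close> and shifts the degree by
  \<open>a i\<close>.\<close>

lemma weighted_gf_insert:
  assumes "finite I" "i \<notin> I" "\<And>j. j \<in> insert i I \<Longrightarrow> a j > 0"
  shows "weighted_gf (insert i I) a c * (1 - fps_const (c i) * fps_X ^ a i) = weighted_gf I a c"
proof (rule fps_ext)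
  fix l
  let ?f = "\<lambda>m. \<Prod>j\<in>insert i I. c j ^ m j"
  let ?u = "\<lambda>m. m(i := Suc (m i))"
  let ?G = "weighted_gf (insert i I) a c"
  have fin: "finite (weighted_sols I a k)" "finite (weighted_sols (insert i I) a k)" for k
    using assms by (auto intro: finite_weighted_sols)
  \<comment> \<open>A solution supported on \<open>I\<close> has \<open>m i = 0\<close>, so the
    extra factor at \<open>i\<close> is 1.\<close>
  have fI: "sum ?f (weighted_sols I a l) = fps_nth (weighted_gf I a c) l"
    using assms by (auto simp: weighted_gf_def weighted_sols_def intro!: sum.cong)
  have fu: "?f (?u m) = c i * ?f m" for m
  proof -
    have "(\<Prod>j\<in>I. c j ^ ?u m j) = (\<Prod>j\<in>I. c j ^ m j)"
      using assms by (intro prod.cong) auto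
    then show ?thesis using assms by simp
  qed
  have inj: "inj ?u"
  proof (rule injI)
    fix x y :: "'a \<Rightarrow> nat" assume e: "?u x = ?u y"
    show "x = y"
    proof
      fix j show "x j = y j" using fun_cong[OF e, of j] by (auto split: if_splits)
    qed
  qed
  have disj: "weighted_sols I a l \<inter> ?u ` S = {}" for S
    using assms by (auto simp: weighted_sols_def)
  have "fps_nth ?G l = fps_nth (weighted_gf I a c) l +
      (if l < a i then 0 else c i * fps_nth ?G (l - a i))"
  proof (cases "l < a i")
    case True
    then show ?thesis
      using weighted_sols_insert[of I i a l] assms fI by (simp add: weighted_gf_def)
  next
    case False
    let ?S = "weighted_sols (insert i I) a (l - a i)"
    have "fps_nth ?G l = sum ?f (weighted_sols I a l \<union> ?u ` ?S)"
      using weighted_sols_insert[of I i a l] assms False by (simp add: weighted_gf_def)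
    also have "\<dots> = sum ?f (weighted_sols I a l) + sum ?f (?u ` ?S)"
      using fin disj by (intro sum.union_disjoint) auto
    also have "sum ?f (?u ` ?S) = (\<Sum>m\<in>?S. c i * ?f m)"
      by (subst sum.reindex) (use inj fu in \<open>auto intro: inj_on_subset simp del: prod.insert\<close>)
    also have "\<dots> = c i * fps_nth ?G (l - a i)"
      by (simp add: weighted_gf_def sum_distrib_left)
    finally show ?thesis using False fI by simp
  qed
  moreover have "fps_nth (?G * (1 - fps_const (c i) * fps_X ^ a i)) l =
      fps_nth ?G l - c i * (if l < a i then 0 else fps_nth ?G (l - a i))"
  proof -
    have "?G * (1 - fps_const (c i) * fps_X ^ a i) = ?G - fps_const (c i) * (?G * fps_X ^ a i)"
      by (simp add: algebra_simps)
    then show ?thesis by (simp add: fps_X_power_mult_right_nth)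
  qed
  ultimately show "fps_nth (?G * (1 - fps_const (c i) * fps_X ^ a i)) l =
      fps_nth (weighted_gf I a c) l" by simp
qed

text \<open>One factor is cancelled for each index. The form "product equal to 1" avoids dividing
  power series over an integral domain.\<close>

lemma weighted_gf_eq:
  assumes "finite I" "\<And>i. i \<in> I \<Longrightarrow> a i > 0"
  shows "weighted_gf I a c * (\<Prod>i\<in>I. 1 - fps_const (c i) * fps_X ^ a i) = 1"
  using assms
proof (induction I rule: finite_induct)
  case empty
  have "weighted_sols {} a l = (if l = 0 then {\<lambda>_. 0} else {})" for l
    by (auto simp: weighted_sols_def)
  then show ?case by (intro fps_ext) (simp add: weighted_gf_def)
next
  case (insert i I)
  then have "weighted_gf (insert i I) a c * (\<Prod>i\<in>insert i I. 1 - fps_const (c i) * fps_X ^ a i)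
     = weighted_gf I a c * (\<Prod>i\<in>I. 1 - fps_const (c i) * fps_X ^ a i)"
    using weighted_gf_insert[of I i a c] by (simp add: mult.assoc[symmetric])
  with insert show ?case by simp
qed

text \<open>The idempotent map \<open>r\<close> selects a representative of each class. A function
  constant on the classes is determined by its values at the representatives, and such a value
  contributes with the total weight of its class.\<close>

lemma card_weighted_sols_constant_on_fibres:
  assumes "finite I" "r ` I \<subseteq> I" "\<And>i. i \<in> I \<Longrightarrow> r (r i) = r i"
  shows "card {m \<in> weighted_sols I a l. \<forall>i\<in>I. m (r i) = m i} =
    card (weighted_sols (r ` I) (\<lambda>j. \<Sum>i | i \<in> I \<and> r i = j. a i) l)"
proof (rule bij_betw_same_card)
  let ?b = "\<lambda>j. \<Sum>i | i \<in> I \<and> r i = j. a i"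
  \<comment> \<open>Mutually inverse maps: restrict to the representatives, or spread the values
    back along \<open>r\<close>. The default 0 is the value that \<open>weighted_sols\<close>
    prescribes outside the index set.\<close>
  let ?res = "\<lambda>m j. if j \<in> r ` I then m j else (0::nat)"
  let ?ext = "\<lambda>m i. if i \<in> I then m (r i) else (0::nat)"
  have sums: "(\<Sum>j\<in>r ` I. ?b j * m j) = (\<Sum>i\<in>I. a i * m (r i))" for m :: "'a \<Rightarrow> nat"
  proof -
    have "(\<Sum>j\<in>r ` I. ?b j * m j) = (\<Sum>j\<in>r ` I. \<Sum>i | i \<in> I \<and> r i = j. a i * m (r i))"
      by (intro sum.cong) (auto simp: sum_distrib_right)
    also have "\<dots> = (\<Sum>i\<in>I. a i * m (r i))"
      using assms(1) by (intro sum.group) auto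
    finally show ?thesis .
  qed
  show "bij_betw ?res {m \<in> weighted_sols I a l. \<forall>i\<in>I. m (r i) = m i}
      (weighted_sols (r ` I) ?b l)"
  proof (rule bij_betw_byWitness[where f' = ?ext])
    show "\<forall>m\<in>{m \<in> weighted_sols I a l. \<forall>i\<in>I. m (r i) = m i}. ?ext (?res m) = m"
      by (auto simp: weighted_sols_def fun_eq_iff)
    show "\<forall>m\<in>weighted_sols (r ` I) ?b l. ?res (?ext m) = m"
      using assms(2,3) by (auto simp: weighted_sols_def fun_eq_iff)
    show "?res ` {m \<in> weighted_sols I a l. \<forall>i\<in>I. m (r i) = m i} \<subseteq> weighted_sols (r ` I) ?b l"
    proof (rule image_subsetI)
      fix m assume "m \<in> {m \<in> weighted_sols I a l. \<forall>i\<in>I. m (r i) = m i}"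
      then show "?res m \<in> weighted_sols (r ` I) ?b l"
        using sums[of "?res m"] by (simp add: weighted_sols_def)
    qed
    show "?ext ` weighted_sols (r ` I) ?b l \<subseteq> {m \<in> weighted_sols I a l. \<forall>i\<in>I. m (r i) = m i}"
    proof (rule image_subsetI)
      fix m assume "m \<in> weighted_sols (r ` I) ?b l"
      then show "?ext m \<in> {m \<in> weighted_sols I a l. \<forall>i\<in>I. m (r i) = m i}"
        using sums[of m] assms(2,3) by (auto simp: weighted_sols_def)
    qed
  qed
qed

text \<open>By \<open>factors\<close>, the weighted series on \<open>I\<close> and the counting
  series on the representatives are both inverse to the same product. Hence they agree, and the
  claim compares their coefficients at \<open>l\<close>.\<close>

lemma card_fixed_weighted_sols:
  fixes c :: "'a \<Rightarrow> 'b::idom"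
  assumes "finite I" "\<And>i. i \<in> I \<Longrightarrow> a i > 0" "r ` I \<subseteq> I" "\<And>i. i \<in> I \<Longrightarrow> r (r i) = r i"
    and factors: "(\<Prod>i\<in>I. 1 - fps_const (c i) * fps_X ^ a i) =
      (\<Prod>j\<in>r ` I. 1 - fps_X ^ (\<Sum>i | i \<in> I \<and> r i = j. a i))"
  shows "of_nat (card {m \<in> weighted_sols I a l. \<forall>i\<in>I. m (r i) = m i}) =
    (\<Sum>m\<in>weighted_sols I a l. \<Prod>i\<in>I. c i ^ m i)"
proof -
  let ?b = "\<lambda>j. \<Sum>i | i \<in> I \<and> r i = j. a i"
  let ?P = "\<Prod>i\<in>I. 1 - fps_const (c i) * fps_X ^ a i"
  have b: "?b j > 0" if "j \<in> r ` I" for j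
    using that assms by (intro sum_pos) auto
  have 1: "weighted_gf I a c * ?P = 1"
    using assms by (intro weighted_gf_eq) auto
  have 2: "weighted_gf (r ` I) ?b (\<lambda>_. 1) * ?P = 1"
    using weighted_gf_eq[of "r ` I" ?b "\<lambda>_. 1 :: 'b"] assms(1) b factors by simp
  have "?P \<noteq> 0" using 1 by auto
  moreover have "weighted_gf (r ` I) ?b (\<lambda>_. 1) * ?P = weighted_gf I a c * ?P"
    by (simp only: 1 2)
  ultimately have "weighted_gf (r ` I) ?b (\<lambda>_. 1) = weighted_gf I a c"
    by (simp only: mult_cancel_right simp_thms)
  then have "fps_nth (weighted_gf (r ` I) ?b (\<lambda>_. 1)) l = fps_nth (weighted_gf I a c) l" by simp
  then show ?thesis
    using card_weighted_sols_constant_on_fibres[OF assms(1,3,4)] by (simp add: weighted_gf_def)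
qed

section \<open>The permutation \<open>upsilon n\<close> and the action of the cyclic group of order
  4\<close>

lemma upsilon_outer:
  assumes "n \<ge> 5"
  shows "upsilon n 0 = n" "upsilon n n = 1" "upsilon n 1 = n - 1" "upsilon n (n - 1) = 0"
  using assms by (auto simp: upsilon_def)

lemma upsilon_inner:
  assumes "2 \<le> i" "i \<le> n - 2"
  shows "upsilon n i = (if even i then i + 1 else i - 1)"
  using assms by (auto simp: upsilon_def)

lemma upsilon_gt:
  assumes "n \<ge> 5" "i > n"
  shows "upsilon n i = i"
  using assms by (auto simp: upsilon_def)

lemma upsilon_cases:
  fixes i n :: nat
  obtains "i = 0" | "i = 1" | "i = n - 1" | "i = n" | "i > n" | "2 \<le> i" "i \<le> n - 2"
  by linarith

text \<open>The 4-cycle moves exactly the indices of comark 1, and the transpositions stay among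
  those of comark 2. This makes the level invariant under the action.\<close>

lemma comark_D_upsilon:
  assumes "odd n" "n \<ge> 5"
  shows "comark_D n (upsilon n i) = comark_D n i"
proof (cases rule: upsilon_cases[where i = i and n = n])
  case 6
  \<comment> \<open>Parity keeps the partner of \<open>i\<close> inside \<open>2..n-2\<close>: as
    \<open>n\<close> is odd, this range starts with an even and ends with an odd number.\<close>
  then have "i + 1 \<noteq> n - 1" if "even i" using that assms by presburger
  moreover have "i - 1 \<noteq> 1" if "odd i" using that by presburger
  ultimately show ?thesis
    using 6 by (auto simp: comark_D_def upsilon_inner)
qed (use assms in \<open>simp_all only: upsilon_outer upsilon_gt, simp_all add: comark_D_def\<close>)

lemma dom_weights_D_eq: "dom_weights_D n l = weighted_sols {..n} (comark_D n) l"
  by (simp add: dom_weights_D_def weighted_sols_def not_le)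

lemma dom_weights_D_comp_upsilon:
  assumes "odd n" "n \<ge> 5" "m \<in> dom_weights_D n l"
  shows "m \<circ> (upsilon n ^^ k) \<in> dom_weights_D n l"
proof (induction k)
  case 0
  then show ?case using assms by simp
next
  case (Suc k)
  let ?m = "m \<circ> (upsilon n ^^ k)"
  have "(\<Sum>i\<le>n. comark_D n i * ?m (upsilon n i)) =
      (\<Sum>i\<le>n. comark_D n (upsilon n i) * ?m (upsilon n i))"
    using assms by (simp add: comark_D_upsilon)
  also have "\<dots> = (\<Sum>i\<le>n. comark_D n i * ?m i)"
    using sum.permute[OF upsilon_permutes[OF assms(1,2)], of "\<lambda>i. comark_D n i * ?m i"]
    by (simp add: comp_def)
  finally have "(\<Sum>i\<le>n. comark_D n i * ?m (upsilon n i)) = l"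
    using Suc by (simp add: dom_weights_D_def)
  moreover have "upsilon n i = i" if "i > n" for i
    using upsilon_gt[OF assms(2) that] .
  ultimately have "(\<lambda>i. ?m (upsilon n i)) \<in> dom_weights_D n l"
    using Suc by (simp add: dom_weights_D_def)
  then show ?case by (simp add: comp_def funpow_swap1)
qed

lemma upsilon_pow_mod4:
  assumes "odd n" "n \<ge> 5"
  shows "upsilon n ^^ (k mod 4) = upsilon n ^^ k"
  by (rule ext, rule funpow_mod_eq, rule upsilon_pow4[OF assms])

text \<open>Precomposition reverses the order of composition, which is harmless because powers of
  one permutation commute. Exponents matter only modulo 4; nonnegativity lets \<open>nat\<close>
  respect their sum.\<close>

lemma sigma4_action_compose:
  assumes "odd n" "n \<ge> 5" "x \<ge> 0" "y \<ge> 0"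
  shows "sigma4_action n l ((x + y) mod 4) =
    compose (dom_weights_D n l) (sigma4_action n l x) (sigma4_action n l y)"
proof -
  have "upsilon n ^^ nat ((x + y) mod 4) = upsilon n ^^ (nat y + nat x)"
    using upsilon_pow_mod4[OF assms(1,2), of "nat y + nat x"] assms
    by (simp add: nat_mod_distrib nat_add_distrib add.commute)
  then show ?thesis
    using assms dom_weights_D_comp_upsilon[OF assms(1,2)]
    by (auto simp: sigma4_action_def compose_def fun_eq_iff funpow_add)
qed

lemma sigma4_action_0: "sigma4_action n l 0 = (\<lambda>m\<in>dom_weights_D n l. m)"
  by (simp add: sigma4_action_def)

lemma sigma4_action_Bij:
  assumes "odd n" "n \<ge> 5" "k \<in> {0..<4}"
  shows "sigma4_action n l k \<in> Bij (dom_weights_D n l)"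
proof -
  \<comment> \<open>\<open>?j\<close> is the inverse of \<open>k\<close> modulo 4, so its action is
    the inverse map; the outer \<open>mod\<close> turns 4 into 0 when \<open>k = 0\<close>.\<close>
  let ?X = "dom_weights_D n l" and ?j = "(4 - k) mod 4"
  have maps: "sigma4_action n l i m \<in> ?X" if "m \<in> ?X" for i m
    using that dom_weights_D_comp_upsilon[OF assms(1,2)] by (simp add: sigma4_action_def)
  have "(k + ?j) mod 4 = 0" "(?j + k) mod 4 = 0" "?j \<ge> 0"
    by (simp_all add: mod_simps)
  then have "compose ?X (sigma4_action n l k) (sigma4_action n l ?j) = (\<lambda>m\<in>?X. m)"
    "compose ?X (sigma4_action n l ?j) (sigma4_action n l k) = (\<lambda>m\<in>?X. m)"
    using sigma4_action_compose[OF assms(1,2), of k ?j l] sigma4_action_compose[OF assms(1,2), of ?j k l]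
      assms(3) by (simp_all add: sigma4_action_0)
  then have "sigma4_action n l k (sigma4_action n l ?j m) = m"
    "sigma4_action n l ?j (sigma4_action n l k m) = m" if "m \<in> ?X" for m
    using that by (metis compose_eq restrict_apply')+
  then have "bij_betw (sigma4_action n l k) ?X ?X"
    using maps by (intro bij_betw_byWitness[where f' = "sigma4_action n l ?j"]) auto
  then show ?thesis by (simp add: Bij_def sigma4_action_def)
qed

lemma group_action_sigma4:
  assumes "odd n" "n \<ge> 5"
  shows "group_action (integer_mod_group 4) (dom_weights_D n l) (sigma4_action n l)"
proof (intro group_action.intro group_hom.intro group_hom_axioms.intro homI)
  fix x y assume "x \<in> carrier (integer_mod_group 4)" "y \<in> carrier (integer_mod_group 4)"
  then have xy: "x \<in> {0..<4}" "y \<in> {0..<4}" by (simp_all add: carrier_integer_mod_group)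
  then show "sigma4_action n l x \<in> carrier (BijGroup (dom_weights_D n l))"
    using sigma4_action_Bij[OF assms] by (simp add: BijGroup_def)
  show "sigma4_action n l (x \<otimes>\<^bsub>integer_mod_group 4\<^esub> y) =
      sigma4_action n l x \<otimes>\<^bsub>BijGroup (dom_weights_D n l)\<^esub> sigma4_action n l y"
    using xy sigma4_action_Bij[OF assms] sigma4_action_compose[OF assms, of x y]
    by (simp add: BijGroup_def)
qed (simp_all add: group_BijGroup)

lemma cyclic_group_integer_mod_group:
  assumes "n > 0"
  shows "cyclic_group (integer_mod_group n)"
proof -
  interpret group "integer_mod_group n" by simp
  show ?thesis
  proof (cases "n = 1")
    case True
    then show ?thesis by (simp add: trivial_imp_cyclic_group trivial_integer_mod_group)
  next
    case False
    have "carrier (integer_mod_group n) = range (\<lambda>k::int. 1 [^]\<^bsub>integer_mod_group n\<^esub> k)"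
    proof (intro equalityI subsetI)
      fix k assume "k \<in> carrier (integer_mod_group n)"
      then have "k = 1 [^]\<^bsub>integer_mod_group n\<^esub> k"
        using assms by (simp add: int_pow_integer_mod_group carrier_integer_mod_group)
      then show "k \<in> range (\<lambda>k::int. 1 [^]\<^bsub>integer_mod_group n\<^esub> k)" by blast
    qed (use assms in \<open>auto simp: int_pow_integer_mod_group carrier_integer_mod_group\<close>)
    with False show ?thesis unfolding cyclic_group by (intro bexI[of _ 1]) auto
  qed
qed

section \<open>Values of the polynomial, and weights fixed by powers of
  \<open>upsilon n\<close>\<close>

lemma poly_dom_weights_poly:
  "poly (map_poly of_nat (dom_weights_poly n l)) \<omega> =
    (\<Sum>m\<in>weighted_sols {..n} (comark_D n) l. \<Prod>i\<le>n. (\<omega> ^ s_D n i) ^ m i)"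
  for \<omega> :: complex
proof -
  have "map_poly of_nat (sum f A) = (\<Sum>x\<in>A. map_poly of_nat (f x) :: complex poly)"
    for f :: "(nat \<Rightarrow> nat) \<Rightarrow> nat poly" and A
    by (intro poly_eqI) (simp add: coeff_map_poly coeff_sum)
  then show ?thesis
    by (simp add: dom_weights_poly_def dom_weights_D_eq poly_sum map_poly_monom poly_monom
        power_sum power_mult)
qed

text \<open>Representatives of the cycles of \<open>upsilon n\<close>; \<open>square_orbit_rep\<close> is for its square.\<close>

definition orbit_rep :: "nat \<Rightarrow> nat \<Rightarrow> nat" where
  "orbit_rep n i = (if i \<in> {0, 1, n - 1, n} then 0 else if odd i then i - 1 else i)"

definition square_orbit_rep :: "nat \<Rightarrow> nat \<Rightarrow> nat" where
  "square_orbit_rep n i = (if i = 1 then 0 else if i = n then n - 1 else i)"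

text \<open>Invariance means being constant on cycles, put into the form that
  \<open>card_fixed_weighted_sols\<close> counts. Indices beyond \<open>n\<close> impose no
  condition, since \<open>upsilon n\<close> fixes them.\<close>

lemma fixed_upsilon_iff:
  assumes "odd n" "n \<ge> 5"
  shows "m \<circ> upsilon n = m \<longleftrightarrow> (\<forall>i\<le>n. m (orbit_rep n i) = m i)"
proof
  assume "m \<circ> upsilon n = m"
  then have inv: "m (upsilon n i) = m i" for i by (simp add: fun_eq_iff)
  note outer = upsilon_outer[OF assms(2)]
  then have "m n = m 0" "m 1 = m 0" "m (n - 1) = m 0"
    using inv[of 0] inv[of n] inv[of 1] by simp_all
  moreover have "upsilon n i = i - 1" if "odd i" "i \<notin> {0, 1, n - 1, n}" "i \<le> n" for i
    using that by (auto simp: upsilon_def)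
  ultimately show "\<forall>i\<le>n. m (orbit_rep n i) = m i"
    using inv by (metis (no_types, lifting) insert_iff empty_iff orbit_rep_def)
next
  assume rep: "\<forall>i\<le>n. m (orbit_rep n i) = m i"
  show "m \<circ> upsilon n = m"
  proof
    fix i
    have "orbit_rep n (upsilon n i) = orbit_rep n i" if "i \<le> n"
    proof (cases rule: upsilon_cases[where i = i and n = n])
      case 6
      then have "i + 1 \<noteq> n - 1" if "even i" using that assms by presburger
      moreover have "i - 1 \<noteq> 1" if "odd i" using that by presburger
      ultimately show ?thesis
        using 6 by (auto simp: orbit_rep_def upsilon_inner)
    qed (use that in \<open>simp_all only: upsilon_outer[OF assms(2)], simp_all add: orbit_rep_def\<close>)
    then show "(m \<circ> upsilon n) i = m i"
      using rep upsilon_le[OF assms, of i] permutes_not_in[OF upsilon_permutes[OF assms], of i]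
      by (cases "i \<le> n") (auto, metis)
  qed
qed

text \<open>The square of \<open>upsilon n\<close> is \<open>(0, 1) (n-1, n)\<close>: the 4-cycle
  splits into two transpositions and the other transpositions disappear. Both sides therefore reduce
  to the same two equations.\<close>

lemma fixed_upsilon_square_iff:
  assumes "odd n" "n \<ge> 5"
  shows "m \<circ> (upsilon n ^^ 2) = m \<longleftrightarrow> (\<forall>i\<le>n. m (square_orbit_rep n i) = m i)"
proof -
  have sq: "(upsilon n ^^ 2) i = upsilon n (upsilon n i)" for i
    by (simp add: numeral_2_eq_2)
  note outer = upsilon_outer[OF assms(2)]
  have inner: "upsilon n (upsilon n i) = i" if i: "2 \<le> i" "i \<le> n - 2" for i
  proof (cases "even i")
    case True
    with i assms have "i + 1 \<le> n - 2" by presburger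
    with i True show ?thesis by (simp add: upsilon_inner)
  next
    case False
    with i have "2 \<le> i - 1" by presburger
    with i False show ?thesis by (simp add: upsilon_inner)
  qed
  have "m \<circ> (upsilon n ^^ 2) = m \<longleftrightarrow> m 0 = m 1 \<and> m n = m (n - 1)"
  proof
    assume "m \<circ> (upsilon n ^^ 2) = m"
    then have "m (upsilon n (upsilon n i)) = m i" for i using sq by (metis comp_apply)
    from this[of 1] this[of n] show "m 0 = m 1 \<and> m n = m (n - 1)"
      by (simp only: outer)
  next
    assume m: "m 0 = m 1 \<and> m n = m (n - 1)"
    show "m \<circ> (upsilon n ^^ 2) = m"
    proof
      fix i
      have "m (upsilon n (upsilon n i)) = m i"
        by (cases rule: upsilon_cases[where i = i and n = n])
          (use m in \<open>simp_all only: outer inner upsilon_gt[OF assms(2)]\<close>)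
      then show "(m \<circ> (upsilon n ^^ 2)) i = m i" by (simp only: comp_apply sq)
    qed
  qed
  moreover have "(\<forall>i\<le>n. m (square_orbit_rep n i) = m i) \<longleftrightarrow> m 0 = m 1 \<and> m n = m (n - 1)"
  proof
    assume rep: "\<forall>i\<le>n. m (square_orbit_rep n i) = m i"
    show "m 0 = m 1 \<and> m n = m (n - 1)"
      using rep[rule_format, of 1] rep[rule_format, of n] assms
      by (auto simp: square_orbit_rep_def split: if_splits)
  next
    assume m: "m 0 = m 1 \<and> m n = m (n - 1)"
    have "m (square_orbit_rep n i) = m i" for i
    proof -
      consider "i = 1" | "i \<noteq> 1" "i = n" | "i \<noteq> 1" "i \<noteq> n" by blast
      then show ?thesis
        by cases (simp_all only: square_orbit_rep_def m if_True if_False simp_thms)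
    qed
    then show "\<forall>i\<le>n. m (square_orbit_rep n i) = m i" by blast
  qed
  ultimately show ?thesis by simp
qed

text \<open>Each of \<open>upsilon n\<close> and its cube is the cube of the other, because the
  ninth power equals the first; invariance thus passes both ways.\<close>

lemma fixed_upsilon_cube_iff:
  assumes "odd n" "n \<ge> 5"
  shows "m \<circ> (upsilon n ^^ 3) = m \<longleftrightarrow> m \<circ> upsilon n = m"
proof -
  have iter: "m \<circ> (f ^^ 3) = m" if "m \<circ> f = m" for f
    using that by (simp add: numeral_3_eq_3 comp_assoc[symmetric])
  have "(upsilon n ^^ 3) ^^ 3 = upsilon n"
    using upsilon_pow_mod4[OF assms, of 9] by (simp add: funpow_mult)
  with iter[of "upsilon n"] iter[of "upsilon n ^^ 3"] show ?thesis by auto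
qed

section \<open>Comparison of the denominators\<close>

lemma prod_factors_order4:
  fixes \<omega> :: "'a::idom"
  assumes "odd n" "n \<ge> 5" "\<omega> ^ 2 = -1"
  shows "(\<Prod>i\<in>{..n}. 1 - fps_const (\<omega> ^ s_D n i) * fps_X ^ comark_D n i) =
    (\<Prod>j\<in>orbit_rep n ` {..n}. 1 - fps_X ^ (\<Sum>i | i \<in> {..n} \<and> orbit_rep n i = j. comark_D n i))"
proof -
  let ?f = "\<lambda>i. 1 - fps_const (\<omega> ^ s_D n i) * fps_X ^ comark_D n i"
  let ?F = "\<lambda>j. {i \<in> {..n}. orbit_rep n i = j}"
  have "prod ?f (?F j) = 1 - fps_X ^ sum (comark_D n) (?F j)" if j: "j \<in> orbit_rep n ` {..n}" for j
  proof (cases "j = 0")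
    case True
    have F: "?F j = {0, 1, n - 1, n}"
      using True assms by (auto simp: orbit_rep_def elim: oddE)
    have s: "s_D n 0 = 0" "s_D n 1 = 2" "s_D n (n - 1) = 1" "s_D n n = 3"
      using assms by (auto simp: s_D_def)
    have c: "comark_D n 0 = 1" "comark_D n 1 = 1" "comark_D n (n - 1) = 1" "comark_D n n = 1"
      by (auto simp: comark_D_def)
    \<comment> \<open>This turns the factor at \<open>n\<close>, where the exponent is 3, into
      \<open>1 + \<omega> X\<close>, the partner of \<open>1 - \<omega> X\<close> at
      \<open>n - 1\<close>.\<close>
    have w3: "\<omega> ^ 3 = - \<omega>" using assms(3) by (simp add: power3_eq_cube power2_eq_square)
    have ww: "fps_const \<omega> * fps_const \<omega> = -1"
      using assms(3) by (simp add: power2_eq_square fps_const_neg[symmetric] del: fps_const_neg)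
    have "prod ?f (?F j) = ?f 0 * ?f 1 * ?f (n - 1) * ?f n"
      unfolding F using assms by (simp add: mult.assoc)
    also have "\<dots> = (1 - fps_X) * (1 + fps_X) * (1 - fps_const \<omega> * fps_X) * (1 + fps_const \<omega> * fps_X)"
      unfolding s c w3 assms(3) by (simp add: fps_const_neg[symmetric] del: fps_const_neg)
    also have "\<dots> = (1 - fps_X * fps_X) * (1 - (fps_const \<omega> * fps_const \<omega>) * (fps_X * fps_X))"
      by (simp add: algebra_simps)
    also have "\<dots> = 1 - fps_X ^ 4"
      unfolding ww by (simp add: algebra_simps power4_eq_xxxx)
    also have "sum (comark_D n) (?F j) = 4"
      unfolding F using assms c by simp
    then have "1 - fps_X ^ 4 = (1 - fps_X ^ sum (comark_D n) (?F j) :: 'a fps)" by simp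
    finally show ?thesis .
  next
    case False
    \<comment> \<open>The remaining classes are the pairs \<open>{j, j + 1}\<close> with
      \<open>j\<close> even and \<open>2 \<le> j\<close>, \<open>j + 1 < n - 1\<close>.\<close>
    have inner: "odd i \<and> j = i - 1 \<or> even i \<and> j = i" "i \<notin> {0, 1, n - 1, n}"
      if "orbit_rep n i = j" for i
      using that False by (auto simp: orbit_rep_def split: if_splits)
    obtain k where k: "k \<le> n" "orbit_rep n k = j" using j by auto
    then have k': "k > 1" "k < n - 1" using inner(2)[OF k(2)] by auto
    have "even j \<and> 2 \<le> j \<and> j + 1 < n - 1"
      using inner(1)[OF k(2)]
    proof
      assume "odd k \<and> j = k - 1"
      with k' show ?thesis by (auto elim!: oddE)
    next
      assume "even k \<and> j = k"
      with k' assms(1) show ?thesis by (auto elim!: oddE evenE)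
    qed
    then have j': "even j" "2 \<le> j" "j + 1 < n - 1" by simp_all
    then have "orbit_rep n j = j" "orbit_rep n (j + 1) = j" by (simp_all add: orbit_rep_def)
    then have "{j, j + 1} \<subseteq> ?F j" using j' by auto
    moreover have "i \<in> {j, j + 1}" if "orbit_rep n i = j" for i
      using inner(1)[OF that] by (auto elim: oddE)
    ultimately have F: "?F j = {j, j + 1}" by blast
    \<comment> \<open>The exponents 0 and 2 give the coefficients 1 and -1, hence the factors
      \<open>1 - X^2\<close> and \<open>1 + X^2\<close>.\<close>
    have "s_D n j = 0" "s_D n (j + 1) = 2" "comark_D n j = 2" "comark_D n (j + 1) = 2"
      using j' by (auto simp: s_D_def comark_D_def)
    then show ?thesis unfolding F using assms(3)
      by (simp add: algebra_simps power4_eq_xxxx fps_const_neg[symmetric] del: fps_const_neg flip: power_add)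
  qed
  then have "(\<Prod>j\<in>orbit_rep n ` {..n}. prod ?f (?F j)) =
      (\<Prod>j\<in>orbit_rep n ` {..n}. 1 - fps_X ^ sum (comark_D n) (?F j))"
    by (rule prod.cong[OF refl])
  moreover have "(\<Prod>j\<in>orbit_rep n ` {..n}. prod ?f (?F j)) = prod ?f {..n}"
    by (intro prod.group) auto
  ultimately show ?thesis by simp
qed

lemma prod_factors_order2:
  assumes "odd n" "n \<ge> 5"
  shows "(\<Prod>i\<in>{..n}. 1 - fps_const ((-1) ^ s_D n i :: 'a::idom) * fps_X ^ comark_D n i) =
    (\<Prod>j\<in>square_orbit_rep n ` {..n}. 1 - fps_X ^ (\<Sum>i | i \<in> {..n} \<and> square_orbit_rep n i = j. comark_D n i))"
    (is "?L = ?R")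
proof -
  let ?M = "{2..n - 2}"
  let ?f = "\<lambda>i. 1 - fps_const ((-1) ^ s_D n i :: 'a) * fps_X ^ comark_D n i"
  let ?F = "\<lambda>j. {i \<in> {..n}. square_orbit_rep n i = j}"
  let ?g = "\<lambda>j. 1 - fps_X ^ sum (comark_D n) (?F j) :: 'a fps"
  have c: "comark_D n 0 = 1" "comark_D n 1 = 1" "comark_D n (n - 1) = 1" "comark_D n n = 1"
    by (auto simp: comark_D_def)
  have s: "s_D n 0 = 0" "s_D n 1 = 2" "s_D n (n - 1) = 1" "s_D n n = 3"
    using assms by (auto simp: s_D_def)
  \<comment> \<open>The four outer indices are kept together: the class \<open>{0, 1}\<close> alone
    gives \<open>(1 - X)^2\<close> on the left but \<open>1 - X^2\<close> on the right.\<close>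
  have "{..n} = {0, 1, n - 1, n} \<union> ?M" using assms by auto
  then have "?L = prod ?f {0, 1, n - 1, n} * prod ?f ?M"
    using assms by (simp only:) (rule prod.union_disjoint, auto)
  also have "prod ?f {0, 1, n - 1, n} = ?f 0 * ?f 1 * ?f (n - 1) * ?f n"
    using assms by (simp add: mult.assoc)
  also have "\<dots> = (1 - fps_X) * (1 - fps_X) * (1 + fps_X) * (1 + fps_X)"
    unfolding s c by (simp add: fps_const_neg[symmetric] del: fps_const_neg)
  also have "\<dots> = (1 - fps_X ^ 2) * (1 - fps_X ^ 2)"
    by (simp add: algebra_simps power2_eq_square)
  finally have L: "?L = (1 - fps_X ^ 2) * (1 - fps_X ^ 2) * prod ?f ?M" .
  have im: "square_orbit_rep n ` {..n} = {0, n - 1} \<union> ?M"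
  proof
    show "square_orbit_rep n ` {..n} \<subseteq> {0, n - 1} \<union> ?M"
      using assms by (auto simp: square_orbit_rep_def)
    have "square_orbit_rep n j = j \<and> j \<le> n" if "j \<in> {0, n - 1} \<union> ?M" for j
      using that assms by (auto simp: square_orbit_rep_def)
    then show "{0, n - 1} \<union> ?M \<subseteq> square_orbit_rep n ` {..n}"
      by (metis atMost_iff image_eqI subsetI)
  qed
  have "?R = prod ?g {0, n - 1} * prod ?g ?M"
    unfolding im using assms by (intro prod.union_disjoint) auto
  also have "prod ?g {0, n - 1} = ?g 0 * ?g (n - 1)" using assms by simp
  also have "?F 0 = {0, 1}" using assms by (auto simp: square_orbit_rep_def)
  also have "?F (n - 1) = {n - 1, n}" using assms by (auto simp: square_orbit_rep_def)
  also have "sum (comark_D n) {0, 1} = 2" using c by simp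
  also have "sum (comark_D n) {n - 1, n} = 2" using c assms by simp
  \<comment> \<open>Inner indices form singleton classes, and their exponents 0 or 2 are even, so
    here the factors agree one by one.\<close>
  also have "prod ?g ?M = prod ?f ?M"
  proof (rule prod.cong[OF refl])
    fix j assume j: "j \<in> ?M"
    have "?F j = {j}" using j assms by (auto simp: square_orbit_rep_def)
    moreover have "even (s_D n j)" using j by (auto simp: s_D_def)
    ultimately show "?g j = ?f j" by simp
  qed
  finally show ?thesis using L by simp
qed

section \<open>Cyclic sieving, one group element at a time\<close>

theorem theorem4p13:
  fixes n l :: nat
  assumes "n \<ge> 5" and "odd n"
  shows "cyclic_sieving (integer_mod_group 4) (dom_weights_D n l) (sigma4_action n l)
           (dom_weights_poly n l)"
proof -
  note n = assms(2,1)
  let ?C = "integer_mod_group 4" and ?X = "dom_weights_D n l"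
  interpret C: group ?C by simp
  have a: "comark_D n i > 0" for i by (simp add: comark_D_def)
  \<comment> \<open>For each group element, three things remain to be supplied: a choice
    \<open>r\<close> of representatives that describes its fixed weights, the idempotence of
    \<open>r\<close>, and the identity of denominators.\<close>
  have count: "of_nat (card {m \<in> ?X. sigma4_action n l g m = m}) =
      poly (map_poly of_nat (dom_weights_poly n l)) \<omega>"
    if fixed: "\<And>m :: nat \<Rightarrow> nat. m \<circ> (upsilon n ^^ nat g) = m \<longleftrightarrow> (\<forall>i\<le>n. m (r i) = m i)"
      and r: "r ` {..n} \<subseteq> {..n}" "\<And>i. i \<le> n \<Longrightarrow> r (r i) = r i"
      and factors: "(\<Prod>i\<in>{..n}. 1 - fps_const (\<omega> ^ s_D n i) * fps_X ^ comark_D n i) =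
        (\<Prod>j\<in>r ` {..n}. 1 - fps_X ^ (\<Sum>i | i \<in> {..n} \<and> r i = j. comark_D n i))"
    for g :: int and r and \<omega> :: complex
  proof -
    have "{m \<in> ?X. sigma4_action n l g m = m} =
        {m \<in> weighted_sols {..n} (comark_D n) l. \<forall>i\<in>{..n}. m (r i) = m i}"
      using fixed by (auto simp: sigma4_action_def dom_weights_D_eq)
    then show ?thesis
      using card_fixed_weighted_sols[OF _ a r(1) _ factors] r(2) by (simp add: poly_dom_weights_poly)
  qed
  have orbit: "orbit_rep n ` {..n} \<subseteq> {..n}" by (auto simp: orbit_rep_def)
  have orbit': "orbit_rep n (orbit_rep n i) = orbit_rep n i" for i
  proof (cases "odd i \<and> i \<notin> {0, 1, n - 1, n}")
    case True
    then have "odd i" by simp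
    with n(1) have "i - 1 \<noteq> 1" "i - 1 \<noteq> n" by presburger+
    with True show ?thesis by (auto simp: orbit_rep_def)
  qed (auto simp: orbit_rep_def)
  have order4: "of_nat (card {m \<in> ?X. sigma4_action n l g m = m}) =
      poly (map_poly of_nat (dom_weights_poly n l)) \<omega>"
    if "g = 1 \<or> g = 3" "primitive_root_of_unity 4 \<omega>" for g \<omega>
  proof -
    have "\<omega> ^ 4 = 1" "\<omega> ^ 2 \<noteq> 1" using that(2) by (auto simp: primitive_root_of_unity_def)
    moreover have "\<omega> ^ 4 - 1 = (\<omega> ^ 2 - 1) * (\<omega> ^ 2 + 1)"
      by (simp add: algebra_simps power2_eq_square power4_eq_xxxx)
    \<comment> \<open>In the factorisation of \<open>\<omega> ^ 4 - 1\<close> the first factor is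
      nonzero by primitivity.\<close>
    ultimately have \<omega>: "\<omega> ^ 2 = -1" by (simp add: eq_neg_iff_add_eq_0)
    have fixed: "m \<circ> (upsilon n ^^ nat g) = m \<longleftrightarrow> (\<forall>i\<le>n. m (orbit_rep n i) = m i)"
      for m :: "nat \<Rightarrow> nat"
      using that(1) fixed_upsilon_iff[OF n, of m] fixed_upsilon_cube_iff[OF n, of m] by auto
    show ?thesis
      by (rule count[OF fixed orbit orbit' prod_factors_order4[OF n \<omega>]])
  qed
  have "of_nat (card {m \<in> ?X. sigma4_action n l g m = m}) =
      poly (map_poly of_nat (dom_weights_poly n l)) \<omega>"
    if g: "g \<in> carrier ?C" and \<omega>: "primitive_root_of_unity (C.ord g) \<omega>" for g \<omega>
  proof -
    \<comment> \<open>The order is the \<open>d\<close> whose multiples are exactly the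
      \<open>k\<close> with \<open>k * g\<close> divisible by 4, which leaves only modular
      arithmetic for each \<open>g\<close>.\<close>
    have ord: "C.ord g = d" if "\<And>k. (int k * g) mod 4 = 0 \<longleftrightarrow> d dvd k" for d
      using that C.ord_unique[OF g, of d] by simp
    have "g \<in> {0..<4}" using g by (simp add: carrier_integer_mod_group)
    then consider "g = 0" | "g = 2" | "g = 1 \<or> g = 3" by fastforce
    then show ?thesis
    proof cases
      case 1
      then have "C.ord g = 1" by (intro ord) simp
      then have "\<omega> = 1" using \<omega> by (simp add: primitive_root_of_unity_def)
      \<comment> \<open>The identity fixes every weight: all classes are singletons, and at
        \<open>\<omega> = 1\<close> the two denominators coincide.\<close>
      then show ?thesis using 1 by (intro count[where r = "\<lambda>i. i"]) (auto simp: Collect_conv_if intro!: prod.cong)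
    next
      case 2
      have "C.ord g = 2" by (intro ord) (unfold 2, presburger)
      then have "\<omega> ^ 2 = 1" "\<omega> \<noteq> 1"
        using \<omega> unfolding primitive_root_of_unity_def by (auto dest: spec[of _ 1])
      then have \<omega>: "\<omega> = -1" by (simp add: power2_eq_1_iff)
      have fixed: "m \<circ> (upsilon n ^^ nat g) = m \<longleftrightarrow> (\<forall>i\<le>n. m (square_orbit_rep n i) = m i)"
        for m :: "nat \<Rightarrow> nat"
        using 2 fixed_upsilon_square_iff[OF n, of m] by simp
      show ?thesis unfolding \<omega>
        by (rule count[OF fixed _ _ prod_factors_order2[OF n]])
          (use n in \<open>auto simp: square_orbit_rep_def\<close>)
    next
      case 3
      then have "C.ord g = 4" by (intro ord) (elim disjE; simp; presburger)
      with 3 \<omega> show ?thesis by (intro order4) auto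
    qed
  qed
  moreover have "finite ?X"
    unfolding dom_weights_D_eq using a by (intro finite_weighted_sols) auto
  ultimately show ?thesis
    using group_action_sigma4[OF n]
    by (simp add: cyclic_sieving_def cyclic_group_integer_mod_group carrier_integer_mod_group)
qed

end
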